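(* Let $E^{\mathrm{ce}}$ be an equivalence relation on $\omega$ extending $=^{\mathrm{ce}}$. If $=^{\mathrm{ce}}<_{\mathrm{Learn}}E^{\mathrm{ce}}$, then there is an order embedding $$\iota\colon(\mathcal{P}_{\mathrm{fin}}(2^{\omega}),\subseteq)\to(\mathcal{E}^{\mathrm{ce}},\leq)$$ such that: (i) $\iota(\emptyset)=[=^{\mathrm{ce}}]_{\equiv_{\mathrm{Learn}}}$; (ii) for every nonempty $P\in\mathcal{P}_{\mathrm{fin}}(2^{\omega})$, we have $\iota(P)<[E^{\mathrm{ce}}]_{\equiv_{\mathrm{Learn}}}$. In particular, $\mathsf{TLH}=(\mathcal{E}^{\mathrm{ce}},\leq)$ is atomless.
   Context: Fix a standard (acceptable) enumeration $(\varphi_e)_{e\in\omega}$ of the partial computable functions and let $W_e=\operatorname{dom}(\varphi_e)$. Write $e=^{\mathrm{ce}}e'$ iff $W_e=W_{e'}$. Let $\mathcal{R}^{\mathrm{ce}}$ be the set of all equivalence relations on $\omega$ extending $=^{\mathrm{ce}}$ (no definability or effectivity is assumed). An enumeration of a set $A$ is a surjection $\mu:\omega\to A$; $\mu[s]$ denotes the finite string $\mu(0),\dots,\mu(s-1)$. A learner is an arbitrary function $\mathbf{M}:\omega^{<\omega}\to\omega$ (no effectivity is assumed). For $E^{\mathrm{ce}}\in\mathcal{R}^{\mathrm{ce}}$, a family $\mathfrak{K}$ of nonempty c.e. sets is $E^{\mathrm{ce}}$-learnable if there is a learner $\mathbf{M}$ such that for every $e$ with $W_e\in\mathfrak{K}$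 and every enumeration $\mu$ of $W_e$ there is $i\in\omega$ with $i\mathrel{E^{\mathrm{ce}}}e$ and $\mathbf{M}(\mu[s])=i$ for all sufficiently large $s$. $E^{\mathrm{ce}}\leq_{\mathrm{Learn}}F^{\mathrm{ce}}$ means that every $E^{\mathrm{ce}}$-learnable family of nonempty c.e. sets is also $F^{\mathrm{ce}}$-learnable; $<_{\mathrm{Learn}}$ is the strict part of this preorder and $\equiv_{\mathrm{Learn}}$ is mutual reducibility. The tolerant learning hierarchy $\mathsf{TLH}$ is the poset $(\mathcal{E}^{\mathrm{ce}},\leq)$ where $\mathcal{E}^{\mathrm{ce}}=\mathcal{R}^{\mathrm{ce}}/{\equiv_{\mathrm{Learn}}}$ and $\leq$ is induced by $\leq_{\mathrm{Learn}}$; its bottom element is $[=^{\mathrm{ce}}]_{\equiv_{\mathrm{Learn}}}$. $\mathcal{P}_{\mathrm{fin}}(X)$ is the set of all finite subsets of $X$. In a poset with bottom $\bot$, an atom is an element $a>\bot$ such that there is no $b$ with $\bot<b<a$; the poset is atomless if it has no atoms. *)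

theory Defs
  imports Complex_Main
begin

section \<open>Partial computable functions and acceptable enumerations\<close>

text \<open>
  Kleene's \<open>\<mu>\<close>-recursive functions. Terms carry no arity; \<open>rec_eval r xs y\<close> means that
  the function denoted by \<open>r\<close>, applied to the argument tuple \<open>xs\<close>, converges with value \<open>y\<close>.
\<close>

datatype recf =
    Zero
  | Succ
  | Proj nat
  | Comp recf "recf list"
  | PrimRec recf recf
  | Mu recf

inductive rec_eval :: "recf \<Rightarrow> nat list \<Rightarrow> nat \<Rightarrow> bool" where
  Zero: "rec_eval Zero xs 0"
| Succ: "rec_eval Succ [x] (Suc x)"
| Proj: "i < length xs \<Longrightarrow> rec_eval (Proj i) xs (xs ! i)"
| Comp: "list_all2 (\<lambda>g y. rec_eval g xs y) gs ys \<Longrightarrow> rec_eval f ys z \<Longrightarrow>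
    rec_eval (Comp f gs) xs z"
| PrimRec_0: "rec_eval f xs y \<Longrightarrow> rec_eval (PrimRec f g) (0 # xs) y"
| PrimRec_Suc: "rec_eval (PrimRec f g) (n # xs) y \<Longrightarrow> rec_eval g (n # y # xs) z \<Longrightarrow>
    rec_eval (PrimRec f g) (Suc n # xs) z"
| Mu: "rec_eval f (n # xs) 0 \<Longrightarrow> (\<forall>m<n. \<exists>k. rec_eval f (m # xs) (Suc k)) \<Longrightarrow>
    rec_eval (Mu f) xs n"

inductive_cases rec_eval_ZeroE: "rec_eval Zero xs y"
inductive_cases rec_eval_SuccE: "rec_eval Succ xs y"
inductive_cases rec_eval_ProjE: "rec_eval (Proj i) xs y"
inductive_cases rec_eval_CompE: "rec_eval (Comp f gs) xs y"
inductive_cases rec_eval_PrimRec_0E: "rec_eval (PrimRec f g) (0 # xs) y"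
inductive_cases rec_eval_PrimRec_SucE: "rec_eval (PrimRec f g) (Suc n # xs) y"
inductive_cases rec_eval_MuE: "rec_eval (Mu f) xs y"

lemma rec_eval_deterministic:
  "rec_eval r xs y \<Longrightarrow> rec_eval r xs z \<Longrightarrow> y = z"
proof (induction arbitrary: z rule: rec_eval.induct)
  case (Zero xs)
  then show ?case by (rule rec_eval_ZeroE) simp
next
  case (Succ x)
  then show ?case by (rule rec_eval_SuccE) simp
next
  case (Proj i xs)
  from Proj.prems show ?case by (rule rec_eval_ProjE) simp
next
  case (Comp xs gs ys f w)
  from Comp.prems show ?case
  proof (rule rec_eval_CompE)
    fix ys'
    assume ys': "list_all2 (\<lambda>g. rec_eval g xs) gs ys'" and f: "rec_eval f ys' z"
    have "length ys = length gs" "length ys' = length gs"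
      using Comp.IH(1) ys' by (auto dest: list_all2_lengthD)
    moreover have "ys ! i = ys' ! i" if "i < length gs" for i
      using list_all2_nthD[OF Comp.IH(1) that] list_all2_nthD[OF ys' that] by blast
    ultimately have "ys = ys'" by (simp add: nth_equalityI)
    with f show "w = z" by (simp add: Comp.IH)
  qed
next
  case (PrimRec_0 f xs y g)
  from PrimRec_0.prems have "rec_eval f xs z" by (rule rec_eval_PrimRec_0E)
  then show ?case by (rule PrimRec_0.IH)
next
  case (PrimRec_Suc f g n xs y w)
  from PrimRec_Suc.prems show ?case
  proof (rule rec_eval_PrimRec_SucE)
    fix y'
    assume "rec_eval (PrimRec f g) (n # xs) y'" and g: "rec_eval g (n # y' # xs) z"
    then have "y = y'" by (simp add: PrimRec_Suc.IH(1))
    with g show "w = z" by (simp add: PrimRec_Suc.IH(2))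
  qed
next
  case (Mu f n xs)
  from Mu.prems show ?case
  proof (rule rec_eval_MuE)
    assume z: "rec_eval f (z # xs) 0" "\<forall>m<z. \<exists>k. rec_eval f (m # xs) (Suc k)"
    have "\<not> z < n" using Mu.IH(2) z(1) by (metis nat.distinct(1))
    moreover have "\<not> n < z" using Mu.IH(1) z(2) by (metis nat.distinct(1))
    ultimately show "n = z" by simp
  qed
qed

definition partial_computable :: "(nat \<Rightarrow> nat option) \<Rightarrow> bool" where
  "partial_computable f \<longleftrightarrow> (\<exists>r. \<forall>x y. f x = Some y \<longleftrightarrow> rec_eval r [x] y)"

definition partial_computable2 :: "(nat \<Rightarrow> nat \<Rightarrow> nat option) \<Rightarrow> bool" where
  "partial_computable2 f \<longleftrightarrow> (\<exists>r. \<forall>x y z. f x y = Some z \<longleftrightarrow> rec_eval r [x, y] z)"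

definition total_computable :: "(nat \<Rightarrow> nat) \<Rightarrow> bool" where
  "total_computable f \<longleftrightarrow> partial_computable (\<lambda>x. Some (f x))"

text \<open>
  Acceptability in the sense of Rogers, in its usual form: the universal function is partial
  computable and the parametrization (s-m-n) theorem holds.
\<close>

definition acceptable :: "(nat \<Rightarrow> nat \<Rightarrow> nat option) \<Rightarrow> bool" where
  "acceptable \<phi> \<longleftrightarrow>
     range \<phi> = {f. partial_computable f} \<and>
     partial_computable2 \<phi> \<and>
     (\<forall>\<psi>. partial_computable2 \<psi> \<longrightarrow>
        (\<exists>s. total_computable s \<and> (\<forall>e x. \<phi> (s e) x = \<psi> e x)))"

section \<open>Learning up to an equivalence relation on indices\<close>

definition W :: "(nat \<Rightarrow> nat \<Rightarrow> nat option) \<Rightarrow> nat \<Rightarrow> nat set" where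
  "W \<phi> e = dom (\<phi> e)"

definition ce_eq :: "(nat \<Rightarrow> nat \<Rightarrow> nat option) \<Rightarrow> nat rel" where
  "ce_eq \<phi> = {(e, e'). W \<phi> e = W \<phi> e'}"

definition R_ce :: "(nat \<Rightarrow> nat \<Rightarrow> nat option) \<Rightarrow> nat rel set" where
  "R_ce \<phi> = {E. equiv UNIV E \<and> ce_eq \<phi> \<subseteq> E}"

definition ce_families :: "(nat \<Rightarrow> nat \<Rightarrow> nat option) \<Rightarrow> nat set set set" where
  "ce_families \<phi> = {K. K \<subseteq> range (W \<phi>) \<and> {} \<notin> K}"

definition learnable :: "(nat \<Rightarrow> nat \<Rightarrow> nat option) \<Rightarrow> nat rel \<Rightarrow> nat set set \<Rightarrow> bool" where
  "learnable \<phi> E K \<longleftrightarrow>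
     (\<exists>M :: nat list \<Rightarrow> nat. \<forall>e \<mu>. W \<phi> e \<in> K \<longrightarrow> range \<mu> = W \<phi> e \<longrightarrow>
        (\<exists>i. (i, e) \<in> E \<and> (\<forall>\<^sub>F s in sequentially. M (map \<mu> [0..<s]) = i)))"

definition learn_le :: "(nat \<Rightarrow> nat \<Rightarrow> nat option) \<Rightarrow> nat rel \<Rightarrow> nat rel \<Rightarrow> bool" where
  "learn_le \<phi> E F \<longleftrightarrow> (\<forall>K \<in> ce_families \<phi>. learnable \<phi> E K \<longrightarrow> learnable \<phi> F K)"

definition learn_less :: "(nat \<Rightarrow> nat \<Rightarrow> nat option) \<Rightarrow> nat rel \<Rightarrow> nat rel \<Rightarrow> bool" where
  "learn_less \<phi> E F \<longleftrightarrow> learn_le \<phi> E F \<and> \<not> learn_le \<phi> F E"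

definition learn_equiv :: "(nat \<Rightarrow> nat \<Rightarrow> nat option) \<Rightarrow> nat rel rel" where
  "learn_equiv \<phi> = {(E, F). E \<in> R_ce \<phi> \<and> F \<in> R_ce \<phi> \<and> learn_le \<phi> E F \<and> learn_le \<phi> F E}"

section \<open>The tolerant learning hierarchy\<close>

definition learn_class :: "(nat \<Rightarrow> nat \<Rightarrow> nat option) \<Rightarrow> nat rel \<Rightarrow> nat rel set" where
  "learn_class \<phi> E = learn_equiv \<phi> `` {E}"

definition TLH :: "(nat \<Rightarrow> nat \<Rightarrow> nat option) \<Rightarrow> nat rel set set" where
  "TLH \<phi> = R_ce \<phi> // learn_equiv \<phi>"

definition TLH_le :: "(nat \<Rightarrow> nat \<Rightarrow> nat option) \<Rightarrow> nat rel set rel" where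
  "TLH_le \<phi> = {(a, b). a \<in> TLH \<phi> \<and> b \<in> TLH \<phi> \<and> (\<exists>E \<in> a. \<exists>F \<in> b. learn_le \<phi> E F)}"

definition is_bottom :: "'a set \<Rightarrow> 'a rel \<Rightarrow> 'a \<Rightarrow> bool" where
  "is_bottom A r z \<longleftrightarrow> z \<in> A \<and> (\<forall>a \<in> A. (z, a) \<in> r)"

definition strictly_below :: "'a rel \<Rightarrow> 'a \<Rightarrow> 'a \<Rightarrow> bool" where
  "strictly_below r a b \<longleftrightarrow> (a, b) \<in> r \<and> a \<noteq> b"

text \<open>Atoms and atomlessness of a poset \<open>(A, r)\<close> with bottom element \<open>z\<close>.\<close>

definition is_atom :: "'a set \<Rightarrow> 'a rel \<Rightarrow> 'a \<Rightarrow> 'a \<Rightarrow> bool" where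
  "is_atom A r z a \<longleftrightarrow>
     a \<in> A \<and> strictly_below r z a \<and> \<not> (\<exists>b \<in> A. strictly_below r z b \<and> strictly_below r b a)"

definition atomless :: "'a set \<Rightarrow> 'a rel \<Rightarrow> 'a \<Rightarrow> bool" where
  "atomless A r z \<longleftrightarrow> \<not> (\<exists>a. is_atom A r z a)"

definition order_embedding :: "'a set \<Rightarrow> 'a rel \<Rightarrow> 'b set \<Rightarrow> 'b rel \<Rightarrow> ('a \<Rightarrow> 'b) \<Rightarrow> bool" where
  "order_embedding A r B s f \<longleftrightarrow>
     f ` A \<subseteq> B \<and> (\<forall>x \<in> A. \<forall>y \<in> A. (x, y) \<in> r \<longleftrightarrow> (f x, f y) \<in> s)"

definition Pfin_le :: "'a set \<Rightarrow> 'a set rel" where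
  "Pfin_le X = {(P, Q). P \<in> Fpow X \<and> Q \<in> Fpow X \<and> P \<subseteq> Q}"

lemma learn_le_refl: "learn_le \<phi> E E"
  by (simp add: learn_le_def)

lemma learn_le_trans: "learn_le \<phi> E F \<Longrightarrow> learn_le \<phi> F G \<Longrightarrow> learn_le \<phi> E G"
  unfolding learn_le_def by blast

lemma equiv_learn_equiv: "equiv (R_ce \<phi>) (learn_equiv \<phi>)"
proof (rule equivI)
  show "learn_equiv \<phi> \<subseteq> R_ce \<phi> \<times> R_ce \<phi>"
    by (auto simp: learn_equiv_def)
  show "refl_on (R_ce \<phi>) (learn_equiv \<phi>)"
    by (auto simp: refl_on_def learn_equiv_def learn_le_refl)
  show "sym (learn_equiv \<phi>)"
    by (auto simp: sym_def learn_equiv_def)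
  show "trans (learn_equiv \<phi>)"
    unfolding trans_def learn_equiv_def using learn_le_trans by fast
qed

lemma learn_class_in_TLH: "E \<in> R_ce \<phi> \<Longrightarrow> learn_class \<phi> E \<in> TLH \<phi>"
  by (simp add: learn_class_def TLH_def quotientI)

lemma TLH_cases:
  assumes "a \<in> TLH \<phi>"
  obtains E where "E \<in> R_ce \<phi>" "a = learn_class \<phi> E"
  using assms unfolding TLH_def learn_class_def by (rule quotientE)

lemma TLH_le_learn_class:
  assumes "E \<in> R_ce \<phi>" "F \<in> R_ce \<phi>"
  shows "(learn_class \<phi> E, learn_class \<phi> F) \<in> TLH_le \<phi> \<longleftrightarrow> learn_le \<phi> E F"
proof
  assume "(learn_class \<phi> E, learn_class \<phi> F) \<in> TLH_le \<phi>"
  then obtain E' F' where "E' \<in> learn_class \<phi> E" "F' \<in> learn_class \<phi> F" "learn_le \<phi> E' F'"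
    unfolding TLH_le_def by blast
  then have "learn_le \<phi> E E'" "learn_le \<phi> E' F'" "learn_le \<phi> F' F"
    by (simp_all add: learn_class_def learn_equiv_def)
  then show "learn_le \<phi> E F" by (meson learn_le_trans)
next
  assume "learn_le \<phi> E F"
  moreover have "E \<in> learn_class \<phi> E" "F \<in> learn_class \<phi> F"
    by (simp_all add: assms learn_class_def learn_equiv_def learn_le_refl)
  ultimately show "(learn_class \<phi> E, learn_class \<phi> F) \<in> TLH_le \<phi>"
    using learn_class_in_TLH[OF assms(1)] learn_class_in_TLH[OF assms(2)]
    unfolding TLH_le_def by blast
qed

lemma learn_class_eq_iff:
  assumes "E \<in> R_ce \<phi>" "F \<in> R_ce \<phi>"
  shows "learn_class \<phi> E = learn_class \<phi> F \<longleftrightarrow> learn_le \<phi> E F \<and> learn_le \<phi> F E"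
  using eq_equiv_class_iff[OF equiv_learn_equiv assms] assms
  by (simp add: learn_class_def) (simp add: learn_equiv_def)

lemma partial_order_TLH: "partial_order_on (TLH \<phi>) (TLH_le \<phi>)"
  unfolding partial_order_on_def preorder_on_def
proof (intro conjI)
  show "TLH_le \<phi> \<subseteq> TLH \<phi> \<times> TLH \<phi>" by (auto simp: TLH_le_def)
  show "refl_on (TLH \<phi>) (TLH_le \<phi>)"
  proof (rule refl_onI)
    fix a assume "a \<in> TLH \<phi>"
    then obtain E where "E \<in> R_ce \<phi>" "a = learn_class \<phi> E" by (rule TLH_cases)
    then show "(a, a) \<in> TLH_le \<phi>" by (simp add: TLH_le_learn_class learn_le_refl)
  qed
  show "trans (TLH_le \<phi>)"
  proof (rule transI)
    fix a b c assume ab: "(a, b) \<in> TLH_le \<phi>" and bc: "(b, c) \<in> TLH_le \<phi>"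
    then have "a \<in> TLH \<phi>" "b \<in> TLH \<phi>" "c \<in> TLH \<phi>" by (auto simp: TLH_le_def)
    then obtain E F G where "E \<in> R_ce \<phi>" "a = learn_class \<phi> E"
      and "F \<in> R_ce \<phi>" "b = learn_class \<phi> F"
      and "G \<in> R_ce \<phi>" "c = learn_class \<phi> G"
      by (elim TLH_cases)
    with ab bc show "(a, c) \<in> TLH_le \<phi>"
      by (simp add: TLH_le_learn_class) (rule learn_le_trans)
  qed
  show "antisym (TLH_le \<phi>)"
  proof (rule antisymI)
    fix a b assume ab: "(a, b) \<in> TLH_le \<phi>" and ba: "(b, a) \<in> TLH_le \<phi>"
    then have "a \<in> TLH \<phi>" "b \<in> TLH \<phi>" by (auto simp: TLH_le_def)
    then obtain E F where "E \<in> R_ce \<phi>" "a = learn_class \<phi> E"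
      and "F \<in> R_ce \<phi>" "b = learn_class \<phi> F"
      by (elim TLH_cases)
    with ab ba show "a = b"
      by (simp add: TLH_le_learn_class learn_class_eq_iff)
  qed
qed

lemma ce_eq_in_R_ce: "ce_eq \<phi> \<in> R_ce \<phi>"
  by (auto simp: R_ce_def ce_eq_def equiv_def refl_on_def sym_def trans_def)

lemma is_bottom_TLH: "is_bottom (TLH \<phi>) (TLH_le \<phi>) (learn_class \<phi> (ce_eq \<phi>))"
proof -
  have le: "learn_le \<phi> (ce_eq \<phi>) E" if "E \<in> R_ce \<phi>" for E
    unfolding learn_le_def
  proof (intro ballI impI)
    fix K assume "learnable \<phi> (ce_eq \<phi>) K"
    moreover have "ce_eq \<phi> \<subseteq> E" using that by (simp add: R_ce_def)
    ultimately show "learnable \<phi> E K" unfolding learnable_def by fast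
  qed
  have "(learn_class \<phi> (ce_eq \<phi>), a) \<in> TLH_le \<phi>" if "a \<in> TLH \<phi>" for a
    using that
  proof (rule TLH_cases)
    fix E assume "E \<in> R_ce \<phi>" "a = learn_class \<phi> E"
    with le show ?thesis by (simp add: TLH_le_learn_class ce_eq_in_R_ce)
  qed
  then show ?thesis
    by (simp add: is_bottom_def learn_class_in_TLH ce_eq_in_R_ce)
qed

end

theory Submission
  imports Defs "HOL-Library.Countable" "HOL-Library.Infinite_Set"
begin

text \<open>
  Without effectivity constraints, a family is learnable up to \<open>E\<close> iff every member \<open>L\<close> has a
  finite tell-tale \<open>D \<subseteq> L\<close>: all members between \<open>D\<close> and \<open>L\<close> are \<open>E\<close>-equivalent to \<open>L\<close>. If \<open>E\<close> learns
  strictly more than equality, then some \<open>L\<close> is the limit of pairwise distinct proper subsets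
  \<open>X\<^sub>0, X\<^sub>1, \<dots>\<close> that are all \<open>E\<close>-equivalent to \<open>L\<close>. Fix an almost disjoint family
  \<open>(A\<^sub>f)\<close> of infinite sets of naturals indexed by \<open>2\<^sup>\<omega>\<close> and send \<open>P\<close> to the relation whose only
  nontrivial class is \<open>{L} \<union> {X\<^sub>n | n \<in> A\<^sub>f, f \<in> P}\<close>. For \<open>f \<notin> P\<close>, the family
  \<open>{L} \<union> {X\<^sub>n | n \<in> A\<^sub>f}\<close> separates this relation from \<open>E\<close> and from the images of all \<open>Q \<ni> f\<close>.
\<close>

section \<open>Tell-tales\<close>

text \<open>Angluin's tell-tale condition with equality of sets weakened to \<open>E\<close>. It is
  stated for indices, since \<open>E\<close> relates indices rather than sets.\<close>

definition telltale :: "(nat \<Rightarrow> nat \<Rightarrow> nat option) \<Rightarrow> nat rel \<Rightarrow> nat set set \<Rightarrow> nat \<Rightarrow> nat set \<Rightarrow> bool"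
  where "telltale \<phi> E K e D \<longleftrightarrow> finite D \<and> D \<subseteq> W \<phi> e \<and>
    (\<forall>e'. W \<phi> e' \<in> K \<longrightarrow> D \<subseteq> W \<phi> e' \<longrightarrow> W \<phi> e' \<subseteq> W \<phi> e \<longrightarrow> (e', e) \<in> E)"

lemma R_ceD:
  assumes "E \<in> R_ce \<phi>"
  shows R_ce_sym: "(x, y) \<in> E \<Longrightarrow> (y, x) \<in> E"
    and R_ce_trans: "(x, y) \<in> E \<Longrightarrow> (y, z) \<in> E \<Longrightarrow> (x, z) \<in> E"
    and R_ce_eq: "W \<phi> x = W \<phi> y \<Longrightarrow> (x, y) \<in> E"
proof -
  have *: "sym E" "trans E" "ce_eq \<phi> \<subseteq> E"
    using assms by (simp_all add: R_ce_def equiv_def)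
  then show "(x, y) \<in> E \<Longrightarrow> (y, x) \<in> E"
    and "(x, y) \<in> E \<Longrightarrow> (y, z) \<in> E \<Longrightarrow> (x, z) \<in> E"
    and "W \<phi> x = W \<phi> y \<Longrightarrow> (x, y) \<in> E"
    using symD[OF *(1)] transD[OF *(2)] *(3) unfolding ce_eq_def by blast+
qed

text \<open>Proper growth makes the lists arbitrarily long, so they have a limit sequence. It serves
  to build an enumeration stage by stage against a learner.\<close>

lemma limit_of_prefixes:
  fixes g :: "nat \<Rightarrow> 'a list"
  assumes step: "\<And>n. \<exists>zs. zs \<noteq> [] \<and> g (Suc n) = g n @ zs"
  shows "\<exists>\<mu>. (\<forall>n. n \<le> length (g n) \<and> map \<mu> [0..<length (g n)] = g n) \<and>
    range \<mu> = (\<Union>n. set (g n))"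
proof -
  have pre: "\<exists>zs. g (n + k) = g n @ zs" for n k
  proof (induction k)
    case (Suc k)
    then show ?case using step[of "n + k"] by auto
  qed simp
  have len: "n \<le> length (g n)" for n
  proof (induction n)
    case (Suc n)
    obtain zs where "zs \<noteq> []" "g (Suc n) = g n @ zs" using step by blast
    then show ?case using Suc by (cases zs) auto
  qed simp
  \<comment> \<open>\<open>g (Suc k)\<close> has length at least \<open>Suc k\<close>, so position
    \<open>k\<close> exists there.\<close>
  define \<mu> where "\<mu> k = g (Suc k) ! k" for k
  have nth: "\<mu> k = g n ! k" if "k < length (g n)" for k n
  proof (cases "n \<le> Suc k")
    case True
    then obtain zs where "g (Suc k) = g n @ zs" using pre[of n "Suc k - n"] by auto
    then show ?thesis using that by (simp add: \<mu>_def nth_append)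
  next
    case False
    then obtain zs where "g n = g (Suc k) @ zs" using pre[of "Suc k" "n - Suc k"] by auto
    then show ?thesis using len[of "Suc k"] by (simp add: \<mu>_def nth_append)
  qed
  have *: "map \<mu> [0..<length (g n)] = g n" for n
    by (rule nth_equalityI) (simp_all add: nth)
  have "range \<mu> = (\<Union>n. set (g n))"
  proof (intro equalityI subsetI)
    fix x assume "x \<in> range \<mu>"
    then obtain k where "x = g (Suc k) ! k" by (auto simp: \<mu>_def)
    then show "x \<in> (\<Union>n. set (g n))"
      using len[of "Suc k"] nth_mem[of k "g (Suc k)"] by (auto intro!: exI[of _ "Suc k"])
  next
    fix x assume "x \<in> (\<Union>n. set (g n))"
    then obtain n where "x \<in> set (map \<mu> [0..<length (g n)])" by (auto simp: *)
    then show "x \<in> range \<mu>" by auto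
  qed
  with len * show ?thesis by blast
qed

lemma enumeration_exists:
  assumes "(A :: nat set) \<noteq> {}"
  obtains \<nu> :: "nat \<Rightarrow> nat" where "range \<nu> = A"
proof -
  obtain a where "a \<in> A" using assms by blast
  then have "range (\<lambda>n. if n \<in> A then n else a) = A" by auto
  then show thesis by (rule that)
qed

text \<open>The Blum-Blum argument. Without a locking string, every string over \<open>L\<close>
  with guess in \<open>C\<close> has an extension over \<open>L\<close> that changes the guess.
  Interleaving such extensions with an enumeration of \<open>L\<close> enumerates \<open>L\<close>
  without convergence to a value in \<open>C\<close>.\<close>

lemma locking_sequence:
  fixes M :: "nat list \<Rightarrow> nat"
  assumes "L \<noteq> {}"
    and conv: "\<And>\<mu>. range \<mu> = L \<Longrightarrow> \<exists>i. i \<in> C \<and> (\<forall>\<^sub>F s in sequentially. M (map \<mu> [0..<s]) = i)"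
  shows "\<exists>\<sigma>. set \<sigma> \<subseteq> L \<and> M \<sigma> \<in> C \<and> (\<forall>\<tau>. set \<tau> \<subseteq> L \<longrightarrow> M (\<sigma> @ \<tau>) = M \<sigma>)"
proof (rule ccontr)
  assume "\<not> ?thesis"
  then have "\<forall>\<sigma>. \<exists>\<tau>. set \<sigma> \<subseteq> L \<longrightarrow> set \<tau> \<subseteq> L \<and> (M \<sigma> \<in> C \<longrightarrow> M (\<sigma> @ \<tau>) \<noteq> M \<sigma>)"
    by blast
  then obtain \<tau> where \<tau>: "\<And>\<sigma>. set \<sigma> \<subseteq> L \<Longrightarrow> set (\<tau> \<sigma>) \<subseteq> L"
      "\<And>\<sigma>. set \<sigma> \<subseteq> L \<Longrightarrow> M \<sigma> \<in> C \<Longrightarrow> M (\<sigma> @ \<tau> \<sigma>) \<noteq> M \<sigma>"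
    by metis
  obtain \<nu> :: "nat \<Rightarrow> nat" where \<nu>: "range \<nu> = L"
    using \<open>L \<noteq> {}\<close> by (rule enumeration_exists)
  \<comment> \<open>The entry \<open>\<nu> n\<close> makes the limit exhaust \<open>L\<close>; the
    block added by \<open>\<tau>\<close> changes the guess whenever that guess lies in
    \<open>C\<close>.\<close>
  define g where "g = rec_nat [] (\<lambda>n \<sigma>. (\<sigma> @ [\<nu> n]) @ \<tau> (\<sigma> @ [\<nu> n]))"
  have g0: "g 0 = []" and gS: "g (Suc n) = (g n @ [\<nu> n]) @ \<tau> (g n @ [\<nu> n])" for n
    by (simp_all add: g_def)
  have "\<exists>zs. zs \<noteq> [] \<and> g (Suc n) = g n @ zs" for n by (simp add: gS)
  from limit_of_prefixes[of g, OF this] obtain \<mu> where len: "\<And>n. n \<le> length (g n)"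
    and pre: "\<And>n. map \<mu> [0..<length (g n)] = g n" and range: "range \<mu> = (\<Union>n. set (g n))"
    by blast
  have gL: "set (g n) \<subseteq> L" for n
  proof (induction n)
    case (Suc n)
    then have "set (g n @ [\<nu> n]) \<subseteq> L" using \<nu> by auto
    with \<tau>(1)[OF this] show ?case by (simp add: gS)
  qed (simp add: g0)
  have "\<nu> n \<in> set (g (Suc n))" for n by (simp add: gS)
  then have "range \<mu> = L" using range gL \<nu> by blast
  then obtain i S where "i \<in> C" and S: "\<And>s. S \<le> s \<Longrightarrow> M (map \<mu> [0..<s]) = i"
    using conv unfolding eventually_sequentially by blast
  \<comment> \<open>Both \<open>\<rho>\<close> and \<open>\<rho> @ \<tau> \<rho>\<close>, which is
    \<open>g (Suc S)\<close>, are prefixes of \<open>\<mu>\<close> of length at least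
    \<open>S\<close>, so the learner must give \<open>i\<close> on both.\<close>
  define \<rho> where "\<rho> = g S @ [\<nu> S]"
  have "\<rho> = take (length \<rho>) (g (Suc S))" by (simp add: gS \<rho>_def)
  also have "\<dots> = take (length \<rho>) (map \<mu> [0..<length (g (Suc S))])" by (simp only: pre)
  also have "\<dots> = map \<mu> [0..<length \<rho>]" by (simp add: take_map gS \<rho>_def del: upt_Suc)
  finally have "map \<mu> [0..<length \<rho>] = \<rho>" by (rule sym)
  then have "M \<rho> = i" using S[of "length \<rho>"] len[of S] by (simp add: \<rho>_def)
  moreover have "M (\<rho> @ \<tau> \<rho>) = i"
    using S[of "length (g (Suc S))"] len[of "Suc S"] by (simp only: pre) (simp add: gS \<rho>_def)
  moreover have "set \<rho> \<subseteq> L" using gL \<nu> by (auto simp: \<rho>_def)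
  ultimately show False using \<tau>(2) \<open>i \<in> C\<close> by auto
qed

text \<open>The content of a locking string \<open>\<sigma>\<close> for \<open>W \<phi> e\<close> is
  a tell-tale. If \<open>W \<phi> e'\<close> lies in between, then \<open>\<sigma>\<close> followed
  by an enumeration of \<open>W \<phi> e'\<close> enumerates \<open>W \<phi> e'\<close>, and the
  learner stays at \<open>M \<sigma>\<close> on it. This guess is therefore equivalent to both
  \<open>e\<close> and \<open>e'\<close>.\<close>

lemma learnable_imp_telltale:
  assumes E: "E \<in> R_ce \<phi>" and K: "K \<in> ce_families \<phi>" and "learnable \<phi> E K" and e: "W \<phi> e \<in> K"
  shows "\<exists>D. telltale \<phi> E K e D"
proof -
  obtain M where "\<forall>e \<mu>. W \<phi> e \<in> K \<longrightarrow> range \<mu> = W \<phi> e \<longrightarrow>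
      (\<exists>i. (i, e) \<in> E \<and> (\<forall>\<^sub>F s in sequentially. M (map \<mu> [0..<s]) = i))"
    using assms(3) unfolding learnable_def by (rule exE)
  then have M: "\<exists>i. (i, e) \<in> E \<and> (\<forall>\<^sub>F s in sequentially. M (map \<mu> [0..<s]) = i)"
    if "W \<phi> e \<in> K" "range \<mu> = W \<phi> e" for e \<mu>
    using that by simp
  have ne: "W \<phi> e' \<noteq> {}" if "W \<phi> e' \<in> K" for e' using K that by (auto simp: ce_families_def)
  have "\<exists>i. i \<in> {i. (i, e) \<in> E} \<and> (\<forall>\<^sub>F s in sequentially. M (map \<mu> [0..<s]) = i)"
    if "range \<mu> = W \<phi> e" for \<mu> using M[OF e that] by simp
  from locking_sequence[of _ "{i. (i, e) \<in> E}" M, OF ne[OF e] this]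
  obtain \<sigma> where \<sigma>: "set \<sigma> \<subseteq> W \<phi> e" "M \<sigma> \<in> {i. (i, e) \<in> E}"
      "\<And>\<tau>. set \<tau> \<subseteq> W \<phi> e \<Longrightarrow> M (\<sigma> @ \<tau>) = M \<sigma>"
    by blast
  have "(e', e) \<in> E" if e': "W \<phi> e' \<in> K" "set \<sigma> \<subseteq> W \<phi> e'" "W \<phi> e' \<subseteq> W \<phi> e" for e'
  proof -
    obtain \<nu> :: "nat \<Rightarrow> nat" where \<nu>: "range \<nu> = W \<phi> e'"
      using ne[OF e'(1)] by (rule enumeration_exists)
    define g where "g n = \<sigma> @ map \<nu> [0..<n]" for n
    have "\<exists>zs. zs \<noteq> [] \<and> g (Suc n) = g n @ zs" for n by (simp add: g_def)
    from limit_of_prefixes[of g, OF this] obtain \<mu> where len: "\<And>n. n \<le> length (g n)"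
      and pre: "\<And>n. map \<mu> [0..<length (g n)] = g n" and range: "range \<mu> = (\<Union>n. set (g n))"
      by blast
    have "\<nu> n \<in> set (g (Suc n))" for n by (simp add: g_def)
    moreover have "set (g n) = set \<sigma> \<union> \<nu> ` {0..<n}" for n by (simp add: g_def)
    ultimately have "(\<Union>n. set (g n)) = set \<sigma> \<union> range \<nu>" by blast
    then have "range \<mu> = W \<phi> e'" using range \<nu> e'(2) by auto
    then obtain i S where "(i, e') \<in> E" and S: "\<And>s. S \<le> s \<Longrightarrow> M (map \<mu> [0..<s]) = i"
      using M[OF e'(1)] unfolding eventually_sequentially by blast
    have "set (map \<nu> [0..<S]) \<subseteq> W \<phi> e" using \<nu> e'(3) by auto
    then have "M (g S) = M \<sigma>" unfolding g_def by (rule \<sigma>(3))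
    moreover have "M (g S) = i" using S[OF len] unfolding pre .
    ultimately have "M \<sigma> = i" by simp
    with \<sigma>(2) have "(i, e) \<in> E" by simp
    with R_ce_sym[OF E \<open>(i, e') \<in> E\<close>] show ?thesis by (rule R_ce_trans[OF E])
  qed
  then show ?thesis using \<sigma>(1) by (intro exI[of _ "set \<sigma>"]) (simp add: telltale_def)
qed

text \<open>The learner guesses the least index in the family that is consistent with the data and
  whose chosen tell-tale has already appeared. No effectivity is demanded, so this is a legitimate
  learner.\<close>

lemma telltale_imp_learnable:
  assumes E: "E \<in> R_ce \<phi>" and tt: "\<And>e. W \<phi> e \<in> K \<Longrightarrow> \<exists>D. telltale \<phi> E K e D"
  shows "learnable \<phi> E K"
proof -
  obtain D where D: "\<And>e. W \<phi> e \<in> K \<Longrightarrow> telltale \<phi> E K e (D e)" using tt by metis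
  define ok where "ok S n \<longleftrightarrow> W \<phi> n \<in> K \<and> D n \<subseteq> S \<and> S \<subseteq> W \<phi> n" for S n
  define M where "M \<sigma> = (LEAST n. ok (set \<sigma>) n)" for \<sigma>
  have "\<exists>i. (i, e) \<in> E \<and> (\<forall>\<^sub>F s in sequentially. M (map \<mu> [0..<s]) = i)"
    if e: "W \<phi> e \<in> K" and \<mu>: "range \<mu> = W \<phi> e" for e \<mu>
  proof (intro exI conjI)
    let ?L = "W \<phi> e"
    \<comment> \<open>The limit guess. It need not be an index of \<open>W \<phi> e\<close>, but
      \<open>W \<phi> e\<close> lies between \<open>D i\<close> and \<open>W \<phi> i\<close>, so
      the tell-tale of \<open>i\<close> gives equivalence with \<open>e\<close>.\<close>
    define i where "i = (LEAST n. ok ?L n)"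
    have "ok ?L e" using D[OF e] e by (simp add: ok_def telltale_def)
    then have i: "ok ?L i" unfolding i_def by (rule LeastI)
    then have tt: "telltale \<phi> E K i (D i)" and "D i \<subseteq> ?L" "?L \<subseteq> W \<phi> i"
      using D by (simp_all add: ok_def)
    then have "(e, i) \<in> E" using e by (simp add: telltale_def)
    then show "(i, e) \<in> E" by (rule R_ce_sym[OF E])
    have ev_mem: "\<forall>\<^sub>F s in sequentially. x \<in> set (map \<mu> [0..<s])" if "x \<in> ?L" for x
    proof -
      obtain k where "x = \<mu> k" using \<mu> \<open>x \<in> ?L\<close> by blast
      then show ?thesis unfolding eventually_sequentially by (intro exI[of _ "Suc k"]) auto
    qed
    have sub: "set (map \<mu> [0..<s]) \<subseteq> ?L" for s using \<mu> by auto
    have "finite (D i)" using tt by (simp add: telltale_def)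
    moreover have "\<forall>x \<in> D i. \<forall>\<^sub>F s in sequentially. x \<in> set (map \<mu> [0..<s])"
      using ev_mem \<open>D i \<subseteq> ?L\<close> by blast
    ultimately have "\<forall>\<^sub>F s in sequentially. \<forall>x \<in> D i. x \<in> set (map \<mu> [0..<s])"
      by (rule eventually_ball_finite)
    then have 1: "\<forall>\<^sub>F s in sequentially. ok (set (map \<mu> [0..<s])) i"
    proof eventually_elim
      case (elim s)
      then show ?case using i sub[of s] unfolding ok_def by blast
    qed
    \<comment> \<open>A smaller index is rejected at every stage, or from the moment an element
      outside its set shows up. There are finitely many such indices, so one stage rejects them
      all.\<close>
    have "\<forall>\<^sub>F s in sequentially. \<not> ok (set (map \<mu> [0..<s])) m" if "m < i" for m
    proof -
      have "\<not> ok ?L m" using that not_less_Least unfolding i_def by blast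
      then consider "W \<phi> m \<notin> K" | "\<not> D m \<subseteq> ?L" | x where "x \<in> ?L" "x \<notin> W \<phi> m"
        unfolding ok_def by blast
      then show ?thesis
      proof cases
        case 1
        then show ?thesis by (simp add: ok_def)
      next
        case 2
        then have "\<not> ok (set (map \<mu> [0..<s])) m" for s
          using sub[of s] unfolding ok_def by blast
        then show ?thesis by simp
      next
        case 3
        from ev_mem[OF 3(1)] show ?thesis
        proof eventually_elim
          case (elim s)
          then show ?case using 3 unfolding ok_def by blast
        qed
      qed
    qed
    then have 2: "\<forall>\<^sub>F s in sequentially. \<forall>m \<in> {..<i}. \<not> ok (set (map \<mu> [0..<s])) m"
      by (intro eventually_ball_finite) blast+
    show "\<forall>\<^sub>F s in sequentially. M (map \<mu> [0..<s]) = i"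
      using 1 2
    proof eventually_elim
      case (elim s)
      show ?case unfolding M_def
        using elim by (intro Least_equality) (auto intro: leI)
    qed
  qed
  then show ?thesis unfolding learnable_def by blast
qed

section \<open>Approximating a set from within one class\<close>

text \<open>A family separating \<open>E\<close> from equality has a member
  \<open>W \<phi> a\<close> with a tell-tale \<open>D0\<close> for \<open>E\<close> but none for
  equality. Hence every finite \<open>D \<subseteq> W \<phi> a\<close> lies in a proper subset of
  \<open>W \<phi> a\<close> from the family that also contains \<open>D0\<close>, and the latter
  makes it equivalent to \<open>a\<close>. Such subsets are chosen recursively.\<close>

lemma approximating_sequence:
  assumes E: "E \<in> R_ce \<phi>" and less: "learn_less \<phi> (ce_eq \<phi>) E"
  obtains b :: "nat \<Rightarrow> nat" and a where "\<forall>n. (b n, a) \<in> E \<and> W \<phi> (b n) \<subset> W \<phi> a \<and> W \<phi> (b n) \<noteq> {}"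
    "inj (\<lambda>n. W \<phi> (b n))"
    "\<forall>D. finite D \<longrightarrow> D \<subseteq> W \<phi> a \<longrightarrow> (\<forall>\<^sub>F n in sequentially. D \<subseteq> W \<phi> (b n))"
proof -
  obtain K where K: "K \<in> ce_families \<phi>" and "learnable \<phi> E K" and "\<not> learnable \<phi> (ce_eq \<phi>) K"
    using less unfolding learn_less_def learn_le_def by blast
  then obtain a where a: "W \<phi> a \<in> K" and no: "\<And>D. \<not> telltale \<phi> (ce_eq \<phi>) K a D"
    using telltale_imp_learnable[OF ce_eq_in_R_ce[of \<phi>], of K] by blast
  obtain D0 where D0: "telltale \<phi> E K a D0"
    using learnable_imp_telltale[OF E K \<open>learnable \<phi> E K\<close> a] by blast
  have ne: "X \<noteq> {}" if "X \<in> K" for X using K that by (auto simp: ce_families_def)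
  define ok where "ok e \<longleftrightarrow> (e, a) \<in> E \<and> W \<phi> e \<in> K \<and> W \<phi> e \<subset> W \<phi> a" for e
  have next_set: "\<exists>e. ok e \<and> D \<subseteq> W \<phi> e" if D: "finite D" "D \<subseteq> W \<phi> a" for D
  proof -
    have "\<not> telltale \<phi> (ce_eq \<phi>) K a (D0 \<union> D)" by (rule no)
    then obtain e where "W \<phi> e \<in> K" "D0 \<union> D \<subseteq> W \<phi> e" "W \<phi> e \<subseteq> W \<phi> a" "W \<phi> e \<noteq> W \<phi> a"
      using D0 D unfolding telltale_def ce_eq_def by blast
    then show ?thesis using D0 unfolding telltale_def ok_def by blast
  qed
  obtain \<nu> :: "nat \<Rightarrow> nat" where \<nu>: "range \<nu> = W \<phi> a"
    using ne[OF a] by (rule enumeration_exists)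
  \<comment> \<open>A state is an index \<open>e\<close> with a finite set that
    \<open>W \<phi> e\<close> and all later sets must contain. In \<open>Q\<close>,
    \<open>\<nu> n \<in> D'\<close> drives the sets towards \<open>W \<phi> a\<close>, and
    \<open>\<not> D' \<subseteq> W \<phi> e\<close> keeps later sets distinct from
    \<open>W \<phi> e\<close>.\<close>
  define P where "P = (\<lambda>(e, D). ok e \<and> finite D \<and> D \<subseteq> W \<phi> e)"
  define Q where "Q n = (\<lambda>(e, D) (e' :: nat, D'). D \<subseteq> D' \<and> \<nu> n \<in> D' \<and> \<not> D' \<subseteq> W \<phi> e)"
    for n :: nat
  have "\<exists>f. \<forall>n. P (f n) \<and> Q n (f n) (f (Suc n))"
  proof (rule dependent_nat_choice)
    obtain e where "ok e" using next_set[of "{}"] by blast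
    then have "P (e, {})" by (simp add: P_def)
    then show "\<exists>p. P p" ..
  next
    fix p n assume "P p"
    obtain e D where p: "p = (e, D)" by (cases p)
    with \<open>P p\<close> have e: "ok e" "finite D" "D \<subseteq> W \<phi> e" by (auto simp: P_def)
    then obtain x where x: "x \<in> W \<phi> a" "x \<notin> W \<phi> e" by (auto simp: ok_def)
    let ?D = "insert x (insert (\<nu> n) D)"
    have "\<nu> n \<in> W \<phi> a" using \<nu> by blast
    moreover have "D \<subseteq> W \<phi> a" using e by (auto simp: ok_def)
    ultimately have "finite ?D" "?D \<subseteq> W \<phi> a" using e(2) x(1) by simp_all
    then obtain e' where "ok e'" "?D \<subseteq> W \<phi> e'" using next_set by blast
    then have "P (e', ?D) \<and> Q n p (e', ?D)" using e(2) x(2) by (simp add: P_def Q_def p subset_insertI2)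
    then show "\<exists>q. P q \<and> Q n p q" ..
  qed
  then obtain f where f: "\<And>n. P (f n)" "\<And>n. Q n (f n) (f (Suc n))" by blast
  define b where "b n = fst (f n)" for n
  define D where "D n = snd (f n)" for n
  have b: "ok (b n)" and Db: "D n \<subseteq> W \<phi> (b n)" for n
    using f(1)[of n] by (auto simp: P_def b_def D_def split: prod.splits)
  have step: "D n \<subseteq> D (Suc n)" "\<nu> n \<in> D (Suc n)" "\<not> D (Suc n) \<subseteq> W \<phi> (b n)" for n
    using f(2)[of n] by (auto simp: Q_def b_def D_def split: prod.splits)
  have mono: "D m \<subseteq> D n" if "m \<le> n" for m n
    using lift_Suc_mono_le[of D, OF step(1) that] .
  have neq: "W \<phi> (b m) \<noteq> W \<phi> (b n)" if "m < n" for m n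
    using mono[of "Suc m" n] that step(3)[of m] Db[of n] by auto
  have "inj (\<lambda>n. W \<phi> (b n))"
    by (rule injI) (metis neq linorder_neqE_nat)
  moreover have "\<forall>\<^sub>F n in sequentially. A \<subseteq> W \<phi> (b n)" if "finite A" "A \<subseteq> W \<phi> a" for A
  proof -
    have "\<forall>\<^sub>F n in sequentially. x \<in> W \<phi> (b n)" if "x \<in> W \<phi> a" for x
    proof -
      obtain k where "x = \<nu> k" using \<nu> \<open>x \<in> W \<phi> a\<close> by blast
      then have "x \<in> W \<phi> (b n)" if "Suc k \<le> n" for n
        using step(2)[of k] mono[OF that] Db[of n] by blast
      then show ?thesis unfolding eventually_sequentially by blast
    qed
    with \<open>A \<subseteq> W \<phi> a\<close> have "\<forall>x \<in> A. \<forall>\<^sub>F n in sequentially. x \<in> W \<phi> (b n)" by blast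
    with \<open>finite A\<close> have "\<forall>\<^sub>F n in sequentially. \<forall>x \<in> A. x \<in> W \<phi> (b n)"
      by (rule eventually_ball_finite)
    then show ?thesis by (simp add: subset_eq)
  qed
  ultimately show thesis
    using that[of b a] b ne unfolding ok_def by metis
qed

section \<open>Collapsing a family of sets to one class\<close>

definition collapse :: "(nat \<Rightarrow> nat \<Rightarrow> nat option) \<Rightarrow> nat set set \<Rightarrow> nat rel" where
  "collapse \<phi> C = ce_eq \<phi> \<union> {(x, y). W \<phi> x \<in> C \<and> W \<phi> y \<in> C}"

lemma collapse_in_R_ce: "collapse \<phi> C \<in> R_ce \<phi>"
proof -
  have iff: "(x, y) \<in> collapse \<phi> C \<longleftrightarrow> W \<phi> x = W \<phi> y \<or> W \<phi> x \<in> C \<and> W \<phi> y \<in> C" for x y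
    by (simp add: collapse_def ce_eq_def)
  have "equiv UNIV (collapse \<phi> C)"
  proof (rule equivI)
    show "refl (collapse \<phi> C)" by (simp add: refl_on_def iff)
    show "sym (collapse \<phi> C)" by (rule symI) (metis iff)
    show "trans (collapse \<phi> C)" by (rule transI) (metis iff)
  qed simp
  then show ?thesis by (simp add: R_ce_def collapse_def)
qed

lemma learn_le_mono: "E \<subseteq> F \<Longrightarrow> learn_le \<phi> E F"
  unfolding learn_le_def learnable_def by fast

lemma learnable_single_class:
  assumes "\<And>e. W \<phi> e \<in> K \<Longrightarrow> (a, e) \<in> E"
  shows "learnable \<phi> E K"
  unfolding learnable_def
proof (intro exI allI impI)
  \<comment> \<open>The left side of \<open>a = a\<close> instantiates the learner by a constant
    function, the right side its limit guess.\<close>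
  show "(a, e) \<in> E \<and> (\<forall>\<^sub>F s in sequentially. a = a)" if "W \<phi> e \<in> K" for e
    using assms[OF that] by simp
qed

text \<open>The sets \<open>W \<phi> (b n)\<close> with \<open>n \<in> I\<close>, together with
  \<open>W \<phi> a\<close>, form one class for \<open>E\<close>, so a constant learner succeeds.
  For \<open>F\<close>, a tell-tale of \<open>W \<phi> a\<close> is contained in almost all
  \<open>W \<phi> (b n)\<close>, so almost all \<open>n \<in> I\<close> would satisfy
  \<open>(b n, a) \<in> F\<close>.\<close>

lemma not_learn_le_by_sequence:
  fixes b :: "nat \<Rightarrow> nat"
  assumes F: "F \<in> R_ce \<phi>"
    and E: "E \<in> R_ce \<phi>" "\<And>n. n \<in> I \<Longrightarrow> (b n, a) \<in> E"
    and b: "\<And>n. W \<phi> (b n) \<subset> W \<phi> a" "\<And>n. W \<phi> (b n) \<noteq> {}"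
    and lim: "\<And>D. finite D \<Longrightarrow> D \<subseteq> W \<phi> a \<Longrightarrow> \<forall>\<^sub>F n in sequentially. D \<subseteq> W \<phi> (b n)"
    and inf: "infinite {n \<in> I. (b n, a) \<notin> F}"
  shows "\<not> learn_le \<phi> E F"
proof
  let ?K = "insert (W \<phi> a) ((\<lambda>n. W \<phi> (b n)) ` I)"
  assume "learn_le \<phi> E F"
  moreover have K: "?K \<in> ce_families \<phi>" using b by (auto simp: ce_families_def)
  moreover have "learnable \<phi> E ?K"
  proof (rule learnable_single_class)
    fix e assume "W \<phi> e \<in> ?K"
    then obtain c where "(c, a) \<in> E" "W \<phi> e = W \<phi> c"
      using E(2) R_ce_eq[OF E(1)] by blast
    then have "(e, a) \<in> E" using R_ce_trans[OF E(1) R_ce_eq[OF E(1)]] by blast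
    then show "(a, e) \<in> E" by (rule R_ce_sym[OF E(1)])
  qed
  ultimately have "learnable \<phi> F ?K" by (simp add: learn_le_def)
  then obtain D where D: "telltale \<phi> F ?K a D"
    using learnable_imp_telltale[OF F K] by blast
  then have "\<forall>\<^sub>F n in sequentially. D \<subseteq> W \<phi> (b n)"
    using lim by (simp add: telltale_def)
  then obtain N where N: "\<And>n. N \<le> n \<Longrightarrow> D \<subseteq> W \<phi> (b n)"
    unfolding eventually_sequentially by blast
  obtain n where n: "N \<le> n" "n \<in> I" "(b n, a) \<notin> F"
    using inf unfolding infinite_nat_iff_unbounded_le by blast
  then have "W \<phi> (b n) \<in> ?K" "D \<subseteq> W \<phi> (b n)" "W \<phi> (b n) \<subseteq> W \<phi> a"
    using N b(1)[of n] by auto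
  then have "(b n, a) \<in> F" using D unfolding telltale_def by blast
  with n show False by simp
qed

section \<open>An almost disjoint family\<close>

text \<open>The coded nodes on the path \<open>f\<close> through the full binary tree; paths give
  the classical almost disjoint family of size continuum.\<close>

definition branch :: "(nat \<Rightarrow> bool) \<Rightarrow> nat set" where
  "branch f = range (\<lambda>n. to_nat (map f [0..<n]))"

lemma infinite_branch: "infinite (branch f)"
proof -
  have "inj (\<lambda>n. to_nat (map f [0..<n]))"
    by (rule injI) (metis inj_eq[OF inj_to_nat] length_map length_upt diff_zero)
  then show ?thesis unfolding branch_def by (rule range_inj_infinite)
qed

text \<open>A common node determines its length, and beyond a place \<open>k\<close> where
  \<open>f\<close> and \<open>g\<close> differ the paths share no node.\<close>

lemma finite_branch_Int:
  assumes "f \<noteq> g"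
  shows "finite (branch f \<inter> branch g)"
proof -
  obtain k where k: "f k \<noteq> g k" using assms by blast
  have "branch f \<inter> branch g \<subseteq> (\<lambda>n. to_nat (map f [0..<n])) ` {..k}"
  proof
    fix x assume "x \<in> branch f \<inter> branch g"
    then obtain m n where x: "x = to_nat (map f [0..<m])" "x = to_nat (map g [0..<n])"
      unfolding branch_def by blast
    then have eq: "map f [0..<m] = map g [0..<n]" by (simp add: inj_eq[OF inj_to_nat])
    then have "m = n" by (metis length_map length_upt diff_zero)
    with eq have "\<not> k < m" using k by (auto simp: map_eq_conv)
    then show "x \<in> (\<lambda>n. to_nat (map f [0..<n])) ` {..k}" using x(1) by auto
  qed
  then show ?thesis by (rule finite_subset) simp
qed

text \<open>Finiteness of \<open>P\<close> matters here: finitely many finite intersections remove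
  only finitely much of an infinite branch.\<close>

lemma infinite_branch_diff:
  assumes "finite P" "f \<notin> P"
  shows "infinite (branch f - (\<Union>g \<in> P. branch g))"
proof -
  have "finite (\<Union>g \<in> P. branch f \<inter> branch g)"
    using assms by (intro finite_UN_I finite_branch_Int) auto
  then have "infinite (branch f - (\<Union>g \<in> P. branch f \<inter> branch g))"
    using infinite_branch by (rule Diff_infinite_finite)
  moreover have "branch f - (\<Union>g \<in> P. branch f \<inter> branch g) = branch f - (\<Union>g \<in> P. branch g)"
    by blast
  ultimately show ?thesis by simp
qed

section \<open>The embedding\<close>

lemma Fpow_embedding:
  assumes E: "E \<in> R_ce \<phi>" and less: "learn_less \<phi> (ce_eq \<phi>) E"
  shows "\<exists>\<iota> :: (nat \<Rightarrow> bool) set \<Rightarrow> nat rel set.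
    order_embedding (Fpow UNIV) (Pfin_le UNIV) (TLH \<phi>) (TLH_le \<phi>) \<iota> \<and>
    \<iota> {} = learn_class \<phi> (ce_eq \<phi>) \<and>
    (\<forall>P \<in> Fpow UNIV. P \<noteq> {} \<longrightarrow> strictly_below (TLH_le \<phi>) (\<iota> P) (learn_class \<phi> E))"
proof -
  obtain b a where seq: "\<forall>n. (b n, a) \<in> E \<and> W \<phi> (b n) \<subset> W \<phi> a \<and> W \<phi> (b n) \<noteq> {}"
    and inj: "inj (\<lambda>n. W \<phi> (b n))"
    and limit: "\<forall>D. finite D \<longrightarrow> D \<subseteq> W \<phi> a \<longrightarrow> (\<forall>\<^sub>F n in sequentially. D \<subseteq> W \<phi> (b n))"
    by (rule approximating_sequence[OF E less])
  have bE: "(b n, a) \<in> E" and b: "W \<phi> (b n) \<subset> W \<phi> a" "W \<phi> (b n) \<noteq> {}" for n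
    using seq by simp_all
  have lim: "\<forall>\<^sub>F n in sequentially. D \<subseteq> W \<phi> (b n)" if "finite D" "D \<subseteq> W \<phi> a" for D
    using limit that by simp
  \<comment> \<open>\<open>W \<phi> a\<close> is always included, so \<open>C {}\<close> is a
    singleton and collapsing it yields plain equality.\<close>
  define C where "C P = insert (W \<phi> a) ((\<lambda>n. W \<phi> (b n)) ` (\<Union>f \<in> P. branch f))" for P
  define G where "G P = collapse \<phi> (C P)" for P
  have G: "G P \<in> R_ce \<phi>" for P by (simp add: G_def collapse_in_R_ce)
  \<comment> \<open>Injectivity prevents \<open>W \<phi> (b n)\<close> from entering the class
    through another position, and properness separates it from \<open>W \<phi> a\<close>.\<close>
  have G_iff: "(b n, a) \<in> G P \<longleftrightarrow> n \<in> (\<Union>f \<in> P. branch f)" for n P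
    using less_imp_neq[OF b(1)[of n]]
      inj_image_mem_iff[OF inj, of n "\<Union>f \<in> P. branch f"]
    by (simp add: G_def C_def collapse_def ce_eq_def)
  have G_sub: "G P \<subseteq> E" for P
  proof -
    have xa: "(x, a) \<in> E" if "W \<phi> x \<in> C P" for x
    proof -
      from that consider "W \<phi> x = W \<phi> a" | n where "W \<phi> x = W \<phi> (b n)"
        unfolding C_def by blast
      then show ?thesis
        by cases (blast intro: R_ce_eq[OF E], rule R_ce_trans[OF E R_ce_eq[OF E] bE])
    qed
    have "(x, y) \<in> E" if "W \<phi> x \<in> C P" "W \<phi> y \<in> C P" for x y
      using xa[OF that(1)] R_ce_sym[OF E xa[OF that(2)]] by (rule R_ce_trans[OF E])
    then show ?thesis
      using R_ce_eq[OF E] unfolding G_def collapse_def ce_eq_def by blast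
  qed
  \<comment> \<open>Used twice: with \<open>F\<close> of the form \<open>G P'\<close> to show that
    the map reflects the order, and with \<open>F = E\<close> to show strictness below
    \<open>E\<close>.\<close>
  have not_le: "\<not> learn_le \<phi> F (G P)"
    if F: "F \<in> R_ce \<phi>" "\<And>n. n \<in> branch f \<Longrightarrow> (b n, a) \<in> F" and P: "finite P" "f \<notin> P" for F f P
  proof (rule not_learn_le_by_sequence[OF G F b lim])
    have "{n \<in> branch f. (b n, a) \<notin> G P} = branch f - (\<Union>g \<in> P. branch g)"
      by (auto simp: G_iff)
    then show "infinite {n \<in> branch f. (b n, a) \<notin> G P}"
      using infinite_branch_diff[OF P] by simp
  qed
  have le_iff: "learn_le \<phi> (G P) (G Q) \<longleftrightarrow> P \<subseteq> Q" if Q: "finite Q" for P Q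
  proof
    assume "P \<subseteq> Q"
    then have "C P \<subseteq> C Q" unfolding C_def by blast
    then have "G P \<subseteq> G Q" unfolding G_def collapse_def by blast
    then show "learn_le \<phi> (G P) (G Q)" by (rule learn_le_mono)
  next
    assume le: "learn_le \<phi> (G P) (G Q)"
    show "P \<subseteq> Q"
    proof
      fix f assume "f \<in> P"
      then have "(b n, a) \<in> G P" if "n \<in> branch f" for n
        using that by (auto simp: G_iff)
      from not_le[OF G this Q] show "f \<in> Q" using le by blast
    qed
  qed
  have "order_embedding (Fpow UNIV) (Pfin_le UNIV) (TLH \<phi>) (TLH_le \<phi>) (\<lambda>P. learn_class \<phi> (G P))"
    unfolding order_embedding_def
    by (auto simp: learn_class_in_TLH G TLH_le_learn_class le_iff Pfin_le_def Fpow_def)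
  moreover have "G {} = ce_eq \<phi>"
    by (auto simp: G_def C_def collapse_def ce_eq_def)
  moreover have "strictly_below (TLH_le \<phi>) (learn_class \<phi> (G P)) (learn_class \<phi> E)"
    if "P \<in> Fpow UNIV" for P
  proof -
    have P: "finite P" using that by (simp add: Fpow_def)
    \<comment> \<open>A finite \<open>P\<close> misses some \<open>f\<close>. All \<open>b n\<close>
      are \<open>E\<close>-equivalent to \<open>a\<close>, so the branch of \<open>f\<close>
      separates \<open>E\<close> from \<open>G P\<close>.\<close>
    have "infinite (UNIV :: (nat \<Rightarrow> bool) set)"
      using finite_fun_UNIVD1[where ?'a = nat and ?'b = bool] by auto
    then obtain f where "f \<notin> P" using P by (metis ex_new_if_finite)
    then have "\<not> learn_le \<phi> E (G P)" by (rule not_le[OF E bE P])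
    then show ?thesis
      using learn_le_mono[OF G_sub]
      by (simp add: strictly_below_def TLH_le_learn_class learn_class_eq_iff G E)
  qed
  ultimately show ?thesis
    by (intro exI[of _ "\<lambda>P. learn_class \<phi> (G P)"]) simp
qed

theorem theorem4p11:
  fixes \<phi> :: "nat \<Rightarrow> nat \<Rightarrow> nat option"
  assumes "acceptable \<phi>"
  shows "(\<forall>E \<in> R_ce \<phi>. learn_less \<phi> (ce_eq \<phi>) E \<longrightarrow>
            (\<exists>\<iota> :: (nat \<Rightarrow> bool) set \<Rightarrow> nat rel set.
               order_embedding (Fpow UNIV) (Pfin_le UNIV) (TLH \<phi>) (TLH_le \<phi>) \<iota> \<and>
               \<iota> {} = learn_class \<phi> (ce_eq \<phi>) \<and>
               (\<forall>P \<in> Fpow UNIV. P \<noteq> {} \<longrightarrow>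
                  strictly_below (TLH_le \<phi>) (\<iota> P) (learn_class \<phi> E)))) \<and>
         atomless (TLH \<phi>) (TLH_le \<phi>) (learn_class \<phi> (ce_eq \<phi>))"
proof
  show "atomless (TLH \<phi>) (TLH_le \<phi>) (learn_class \<phi> (ce_eq \<phi>))"
    unfolding atomless_def
  proof
    let ?z = "learn_class \<phi> (ce_eq \<phi>)"
    assume "\<exists>x. is_atom (TLH \<phi>) (TLH_le \<phi>) ?z x"
    then obtain x where x: "x \<in> TLH \<phi>" "strictly_below (TLH_le \<phi>) ?z x"
      and atom: "\<And>y. y \<in> TLH \<phi> \<Longrightarrow> strictly_below (TLH_le \<phi>) ?z y \<Longrightarrow>
        \<not> strictly_below (TLH_le \<phi>) y x"
      unfolding is_atom_def by blast
    obtain E where E: "E \<in> R_ce \<phi>" and xE: "x = learn_class \<phi> E"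
      using x(1) by (rule TLH_cases)
    have "learn_less \<phi> (ce_eq \<phi>) E"
      using x(2) E ce_eq_in_R_ce[of \<phi>]
      by (auto simp: strictly_below_def xE learn_less_def TLH_le_learn_class learn_class_eq_iff)
    then obtain \<iota> :: "(nat \<Rightarrow> bool) set \<Rightarrow> nat rel set" where
      emb: "order_embedding (Fpow UNIV) (Pfin_le UNIV) (TLH \<phi>) (TLH_le \<phi>) \<iota>"
      and bot: "\<iota> {} = ?z"
      and below: "\<forall>P \<in> Fpow UNIV. P \<noteq> {} \<longrightarrow> strictly_below (TLH_le \<phi>) (\<iota> P) (learn_class \<phi> E)"
      using Fpow_embedding[OF E] by blast
    \<comment> \<open>Any nonempty finite set would do: its image lies strictly between the bottom
      and the supposed atom.\<close>
    define P where "P = {\<lambda>_ :: nat. True}"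
    have P: "P \<in> Fpow UNIV" "{} \<in> Fpow (UNIV :: (nat \<Rightarrow> bool) set)" "P \<noteq> {}"
      by (auto simp: P_def Fpow_def)
    \<comment> \<open>If \<open>\<iota> P\<close> were the bottom \<open>\<iota> {}\<close>,
      reflexivity at \<open>P\<close> would give \<open>\<iota> P\<close> below
      \<open>\<iota> {}\<close>, against \<open>(P, {}) \<notin> Pfin_le UNIV\<close>.\<close>
    have "({}, P) \<in> Pfin_le UNIV" "(P, {}) \<notin> Pfin_le UNIV" "(P, P) \<in> Pfin_le UNIV"
      using P by (auto simp: Pfin_le_def)
    then have "strictly_below (TLH_le \<phi>) ?z (\<iota> P)" and "\<iota> P \<in> TLH \<phi>"
      using emb P(1,2) unfolding order_embedding_def strictly_below_def bot[symmetric] by auto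
    then show False using atom below P xE by blast
  qed
qed (use Fpow_embedding in blast)

end
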